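(* Let $0\le\beta<1$ and let $f$ be a continuous function on $[0,\infty)$. Then, as $n\to\infty$, the sequence $\{D_n^{\beta}(f,x)\}$ converges to $f(x)$ uniformly for $x\in[a,b]$, where $[a,b]\subset[0,\infty)$.
   Context: For $0\le\beta<1$, a positive integer $n$, an integer $k\ge 0$ and $x\in[0,\infty)$, the basis function is $$L_{n,k}^{(\beta)}(x)=\frac{nx(nx+k\beta)^{k-1}}{k!}e^{-(nx+k\beta)}$$ (for $k=0$ this is $e^{-nx}$). The operators $D_n^{\beta}$ are $$D_n^{\beta}(f,x)=\sum_{k=0}^{\infty}\left(\int_0^\infty L_{n,k}^{(\beta)}(t)\,dt\right)^{-1}L_{n,k}^{(\beta)}(x)\int_0^\infty L_{n,k}^{(\beta)}(t)f(t)\,dt .$$ The parameter $\beta$ is fixed (it does not depend on $n$).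
   Formalization: It is additionally assumed that, for all sufficiently large n, the integrals of L_{n,k} f (all k) and the series defining D_n(f,x) (all x ≥ 0) converge; for continuous f such as exp(t^2) they diverge and the operators are undefined. *)

theory Defs
  imports "HOL-Analysis.Analysis"
begin

text \<open>
  The case \<open>k = 0\<close> is split off because the general formula would then contain the exponent
  \<open>k - 1 = -1\<close>; its value there is \<open>exp (- n x)\<close>, also at \<open>x = 0\<close>.
\<close>

definition jain_basis :: "real \<Rightarrow> nat \<Rightarrow> nat \<Rightarrow> real \<Rightarrow> real" where
  "jain_basis \<beta> n k x =
     (if k = 0 then exp (- (real n * x))
      else real n * x * (real n * x + real k * \<beta>) ^ (k - 1) / fact k
             * exp (- (real n * x + real k * \<beta>)))"

definition jain_durrmeyer_term ::
    "real \<Rightarrow> nat \<Rightarrow> (real \<Rightarrow> real) \<Rightarrow> real \<Rightarrow> nat \<Rightarrow> real" where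
  "jain_durrmeyer_term \<beta> n f x k =
     inverse (LBINT t:{0..}. jain_basis \<beta> n k t) * jain_basis \<beta> n k x
       * (LBINT t:{0..}. jain_basis \<beta> n k t * f t)"

definition jain_durrmeyer :: "real \<Rightarrow> nat \<Rightarrow> (real \<Rightarrow> real) \<Rightarrow> real \<Rightarrow> real" where
  "jain_durrmeyer \<beta> n f x = (\<Sum>k. jain_durrmeyer_term \<beta> n f x k)"

text \<open>
  Both the Lebesgue integral and \<^const>\<open>suminf\<close> are total and return junk values on divergent
  input. The next predicate says that the integrals and the series defining
  \<open>jain_durrmeyer \<beta> n f\<close> on \<open>[0,\<infinity>)\<close> really converge. This can fail for
  continuous \<open>f\<close>, e.g. \<open>f t = exp (t^2)\<close>, for which all integrals diverge.
\<close>

definition jain_durrmeyer_defined :: "real \<Rightarrow> nat \<Rightarrow> (real \<Rightarrow> real) \<Rightarrow> bool" where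
  "jain_durrmeyer_defined \<beta> n f \<longleftrightarrow>
     (\<forall>k. set_integrable lborel {0..} (\<lambda>t. jain_basis \<beta> n k t * f t)) \<and>
     (\<forall>x\<ge>0. summable (jain_durrmeyer_term \<beta> n f x))"

end

theory Submission
  imports Defs "HOL-Probability.Sinc_Integral" "HOL-Real_Asymp.Real_Asymp"
begin

text \<open>
  Every basis function is \<open>L\<^sub>k(nx)\<close> for weights \<open>L\<^sub>k\<close> (\<open>jain_weight\<close>) that do not depend on \<open>n\<close> and
  satisfy \<open>L\<^sub>k'(\<alpha>) = L\<^sub>k\<^sub>-\<^sub>1(\<alpha> + \<beta>) - L\<^sub>k(\<alpha>)\<close>. Hence the deficit \<open>R = 1 - \<Sum>\<^sub>k L\<^sub>k\<close> takes values in
  \<open>[0, 1]\<close>, and \<open>R(\<alpha>)\<close> is the integral of \<open>R\<close> over \<open>[\<alpha>, \<alpha> + \<beta>]\<close> minus its integral over \<open>[0, \<beta>]\<close>.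
  So \<open>sup R \<le> \<beta> sup R\<close>, which forces \<open>R = 0\<close> because \<open>\<beta> < 1\<close>: the weights sum to \<open>1\<close>.

  Comparison with Poisson weights at \<open>u = nx + k\<beta>\<close> and \<open>v = nt + k\<beta>\<close> shows that
  \<open>n \<Sum>\<^sub>k L\<^sub>k(nx) L\<^sub>k(nt) exp(Nt)\<close> tends to \<open>0\<close> uniformly over \<open>x \<in> [0, b]\<close> and \<open>|t - x| \<ge> \<delta>\<close>, for each
  \<open>N\<close>. For \<open>k \<le> mn\<close> the product of the two Poisson weights is at most \<open>exp(-(\<surd>u - \<surd>v)\<^sup>2)\<close>; for larger
  \<open>k\<close> the weight \<open>L\<^sub>k(nx)\<close> decays geometrically in \<open>k\<close>. Integrability of \<open>f\<close> against the basis
  function with \<open>k = 0\<close> says that \<open>|f|\<close> is integrable against \<open>exp(-Nt)\<close> for some \<open>N\<close>, so the part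
  \<open>|t - x| \<ge> \<delta>\<close> of the integrals is negligible; on the rest \<open>f\<close> is uniformly continuous.
\<close>

section \<open>Jain's generalized Poisson weights\<close>

text \<open>These are the point masses of the generalized Poisson distribution of Consul and Jain;
  \<beta> = 0 gives the Poisson distribution with mean \<alpha>.\<close>

definition jain_weight :: "real \<Rightarrow> nat \<Rightarrow> real \<Rightarrow> real" where
  "jain_weight \<beta> k \<alpha> =
     (if k = 0 then exp (- \<alpha>)
      else \<alpha> * (\<alpha> + real k * \<beta>) ^ (k - 1) / fact k * exp (- (\<alpha> + real k * \<beta>)))"

lemma jain_basis_scale: "jain_basis \<beta> n k x = jain_weight \<beta> k (real n * x)"
  by (simp add: jain_basis_def jain_weight_def)

lemma jain_weight_nonneg: "0 \<le> \<beta> \<Longrightarrow> 0 \<le> \<alpha> \<Longrightarrow> 0 \<le> jain_weight \<beta> k \<alpha>"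
  by (simp add: jain_weight_def)

lemma continuous_on_jain_weight [continuous_intros]: "continuous_on X (jain_weight \<beta> k)"
  unfolding jain_weight_def by (cases "k = 0") (auto intro!: continuous_intros)

text \<open>Both weights on the right contain the same base
  \<open>u = \<alpha> + (k + 1) * \<beta>\<close>, since shifting \<alpha> by \<beta> makes up for
  lowering the index by one.\<close>

lemma jain_weight_has_derivative:
  "(jain_weight \<beta> (Suc k) has_real_derivative
      jain_weight \<beta> k (\<alpha> + \<beta>) - jain_weight \<beta> (Suc k) \<alpha>) (at \<alpha>)"
proof (cases k)
  case 0
  have *: "jain_weight \<beta> (Suc k) = (\<lambda>\<alpha>. \<alpha> * exp (- (\<alpha> + \<beta>)))"
    by (auto simp: jain_weight_def 0)
  show ?thesis
    unfolding * by (auto intro!: derivative_eq_intros simp: 0 jain_weight_def algebra_simps)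
next
  case (Suc j)
  define u where "u = \<alpha> + (real j + 2) * \<beta>"
  have *: "jain_weight \<beta> (Suc k)
      = (\<lambda>\<alpha>. \<alpha> * (\<alpha> + (real j + 2) * \<beta>) ^ Suc j / fact (Suc (Suc j)) * exp (- (\<alpha> + (real j + 2) * \<beta>)))"
    by (auto simp: jain_weight_def Suc algebra_simps)
  have p: "((\<lambda>\<alpha>. \<alpha> * (\<alpha> + (real j + 2) * \<beta>) ^ Suc j / fact (Suc (Suc j))) has_real_derivative
      (u ^ Suc j + \<alpha> * (real (Suc j) * u ^ j)) / fact (Suc (Suc j))) (at \<alpha>)"
    unfolding u_def by (rule derivative_eq_intros refl)+ simp_all
  have e: "((\<lambda>\<alpha>. exp (- (\<alpha> + (real j + 2) * \<beta>))) has_real_derivative - exp (- u)) (at \<alpha>)"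
    unfolding u_def by (auto intro!: derivative_eq_intros)
  have d: "(jain_weight \<beta> (Suc k) has_real_derivative
      (u ^ Suc j + \<alpha> * (real (Suc j) * u ^ j)) / fact (Suc (Suc j)) * exp (- u)
        - \<alpha> * u ^ Suc j / fact (Suc (Suc j)) * exp (- u)) (at \<alpha>)"
    unfolding * by (rule DERIV_cong[OF DERIV_mult[OF p e]]) (simp add: u_def mult.commute)
  \<comment> \<open>The bracket is \<open>u ^ j * (u + (j + 1) * \<alpha>)\<close>, and
    \<open>u + (j + 1) * \<alpha> = (j + 2) * (\<alpha> + \<beta>)\<close>; the factor
    \<open>j + 2\<close> cancels against the factorial.\<close>
  have q: "(u ^ Suc j + \<alpha> * (real (Suc j) * u ^ j)) / fact (Suc (Suc j))
      = (\<alpha> + \<beta>) * u ^ j / fact (Suc j)"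
    by (simp add: u_def divide_simps) (simp add: algebra_simps)
  have w: "jain_weight \<beta> k (\<alpha> + \<beta>) = (\<alpha> + \<beta>) * u ^ j / fact (Suc j) * exp (- u)"
    by (simp add: jain_weight_def Suc u_def algebra_simps)
  have ws: "jain_weight \<beta> (Suc k) \<alpha> = \<alpha> * u ^ Suc j / fact (Suc (Suc j)) * exp (- u)"
    by (simp only: * u_def)
  show ?thesis
    using d by (simp only: q w ws)
qed

section \<open>Partial sums and total mass of the weights\<close>

lemma jain_weight_0: "jain_weight \<beta> k 0 = (if k = 0 then 1 else 0)"
  by (simp add: jain_weight_def)

lemma jain_partial_sum_has_derivative:
  "((\<lambda>\<alpha>. \<Sum>k\<le>Suc K. jain_weight \<beta> k \<alpha>) has_real_derivative
      (\<Sum>k\<le>K. jain_weight \<beta> k (\<alpha> + \<beta>)) - (\<Sum>k\<le>Suc K. jain_weight \<beta> k \<alpha>)) (at \<alpha>)"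
proof -
  have 0: "(jain_weight \<beta> 0 has_real_derivative - jain_weight \<beta> 0 \<alpha>) (at \<alpha>)"
    unfolding jain_weight_def by (auto intro!: derivative_eq_intros)
  have "((\<lambda>\<alpha>. jain_weight \<beta> 0 \<alpha> + (\<Sum>k\<le>K. jain_weight \<beta> (Suc k) \<alpha>)) has_real_derivative
      - jain_weight \<beta> 0 \<alpha> + (\<Sum>k\<le>K. jain_weight \<beta> k (\<alpha> + \<beta>) - jain_weight \<beta> (Suc k) \<alpha>)) (at \<alpha>)"
    by (intro DERIV_add 0 DERIV_sum jain_weight_has_derivative)
  then show ?thesis
    by (simp only: sum.atMost_Suc_shift) (simp add: sum_subtractf algebra_simps)
qed

text \<open>Induction on \<open>K\<close> with the integrating factor \<open>exp \<alpha>\<close>: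
  the derivative of \<open>exp \<alpha> * (S (Suc K) \<alpha> - 1)\<close> is
  \<open>exp \<alpha> * (S K (\<alpha> + \<beta>) - 1)\<close>, which is nonpositive by the
  induction hypothesis at the shifted point, and the function vanishes at 0.\<close>

lemma jain_partial_sum_le_1:
  assumes "0 \<le> \<beta>" "0 \<le> \<alpha>"
  shows "(\<Sum>k\<le>K. jain_weight \<beta> k \<alpha>) \<le> 1"
  using assms(2)
proof (induction K arbitrary: \<alpha>)
  case 0
  then show ?case by (simp add: jain_weight_def)
next
  case (Suc K)
  define S where "S K \<alpha> = (\<Sum>k\<le>K. jain_weight \<beta> k \<alpha>)" for K \<alpha>
  have "exp \<alpha> * (S (Suc K) \<alpha> - 1) \<le> exp 0 * (S (Suc K) 0 - 1)"
  proof (rule DERIV_nonpos_imp_nonincreasing[OF Suc.prems])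
    fix s assume s: "0 \<le> s" "s \<le> \<alpha>"
    have "((\<lambda>s. exp s * (S (Suc K) s - 1)) has_real_derivative
        exp s * (S (Suc K) s - 1) + exp s * (S K (s + \<beta>) - S (Suc K) s)) (at s)"
      unfolding S_def
      by (rule derivative_eq_intros jain_partial_sum_has_derivative refl)+ (simp add: algebra_simps)
    moreover have "exp s * (S (Suc K) s - 1) + exp s * (S K (s + \<beta>) - S (Suc K) s)
        = exp s * (S K (s + \<beta>) - 1)"
      by (simp add: algebra_simps)
    moreover have "S K (s + \<beta>) \<le> 1"
      using Suc.IH[of "s + \<beta>"] s assms(1) by (simp add: S_def)
    ultimately show "\<exists>y. ((\<lambda>s. exp s * (S (Suc K) s - 1)) has_real_derivative y) (at s) \<and> y \<le> 0"
      by (metis diff_le_0_iff_le exp_ge_zero mult_nonneg_nonpos)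
  qed
  also have "S (Suc K) 0 = 1"
    by (simp add: S_def jain_weight_0 sum.atMost_Suc_shift del: sum.atMost_Suc)
  finally have "exp \<alpha> * (S (Suc K) \<alpha> - 1) \<le> 0" by simp
  then show ?case
    by (simp add: S_def mult_le_0_iff)
qed

lemma jain_weight_sums_1:
  assumes "0 \<le> \<beta>" "\<beta> < 1" "0 \<le> \<alpha>"
  shows "(\<lambda>k. jain_weight \<beta> k \<alpha>) sums 1"
proof -
  define S where "S K \<alpha> = (\<Sum>k\<le>K. jain_weight \<beta> k \<alpha>)" for K \<alpha>
  have summ: "summable (\<lambda>k. jain_weight \<beta> k \<alpha>)" if "0 \<le> \<alpha>" for \<alpha>
    using bounded_imp_summable[where B = 1] jain_weight_nonneg jain_partial_sum_le_1 assms(1) that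
    by metis
  define R where "R \<alpha> = 1 - (\<Sum>k. jain_weight \<beta> k \<alpha>)" for \<alpha>
  have lim: "(\<lambda>K. S K \<alpha>) \<longlonglongrightarrow> 1 - R \<alpha>" if "0 \<le> \<alpha>" for \<alpha>
    using summable_LIMSEQ'[OF summ[OF that]] by (simp add: S_def R_def)
  have S_bounds: "0 \<le> S K \<alpha>" "S K \<alpha> \<le> 1" if "0 \<le> \<alpha>" for K \<alpha>
    using jain_weight_nonneg jain_partial_sum_le_1 assms(1) that by (auto simp: S_def intro!: sum_nonneg)
  have R_nonneg: "0 \<le> R \<alpha>" if "0 \<le> \<alpha>" for \<alpha>
    using LIMSEQ_le_const2[OF lim[OF that], of 1] S_bounds[OF that] by simp
  have R_le_1: "R \<alpha> \<le> 1" if "0 \<le> \<alpha>" for \<alpha>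
    using LIMSEQ_le_const[OF lim[OF that], of 0] S_bounds[OF that] by simp
  have S_cont: "continuous_on X (S K)" for K X
    unfolding S_def by (intro continuous_intros continuous_on_jain_weight)
  \<comment> \<open>Integrability of \<open>R\<close> comes from dominated convergence of the
    continuous functions \<open>1 - S K\<close>, so continuity of \<open>R\<close> need not be
    established.\<close>
  have R_int: "R integrable_on {p..q}" if "0 \<le> p" for p q
  proof (rule dominated_convergence(1)[where h = "\<lambda>_. 1" and f = "\<lambda>K \<alpha>. 1 - S K \<alpha>"])
    show "(\<lambda>\<alpha>. 1 - S K \<alpha>) integrable_on {p..q}" for K
      by (intro integrable_continuous_interval continuous_intros S_cont)
    show "norm (1 - S K \<alpha>) \<le> 1" if "\<alpha> \<in> {p..q}" for K \<alpha>
      using S_bounds[of \<alpha> K] that \<open>0 \<le> p\<close> by auto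
    show "(\<lambda>K. 1 - S K \<alpha>) \<longlonglongrightarrow> R \<alpha>" if "\<alpha> \<in> {p..q}" for \<alpha>
      using tendsto_diff[OF tendsto_const[of 1] lim, of \<alpha>] that \<open>0 \<le> p\<close> by simp
  qed auto
  have R_eq: "R \<alpha> = integral {\<alpha>..\<alpha> + \<beta>} R - integral {0..\<beta>} R" if "0 \<le> \<alpha>" for \<alpha>
  proof -
    have S0: "S K 0 = 1" for K
      unfolding S_def by (induction K) (auto simp: jain_weight_0)
    have FTC: "((\<lambda>s. S (Suc K) s - S K (s + \<beta>)) has_integral 1 - S (Suc K) \<alpha>) {0..\<alpha>}" for K
    proof -
      have "((\<lambda>s. S K (s + \<beta>) - S (Suc K) s) has_integral S (Suc K) \<alpha> - S (Suc K) 0) {0..\<alpha>}"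
        unfolding S_def
        by (rule fundamental_theorem_of_calculus[OF that])
          (use jain_partial_sum_has_derivative has_real_derivative_iff_has_vector_derivative
            has_vector_derivative_at_within in blast)
      from has_integral_neg[OF this] show ?thesis by (simp add: S0)
    qed
    \<comment> \<open>The derivative rule for partial sums, integrated over
      \<open>{0..\<alpha>}\<close>, passes to the limit because the integrands are differences of
      numbers in [0, 1].\<close>
    have "((\<lambda>s. R (s + \<beta>) - R s) has_integral R \<alpha>) {0..\<alpha>}"
    proof (rule has_integral_dominated_convergence[where h = "\<lambda>_. 1", OF FTC])
      show "\<forall>s\<in>{0..\<alpha>}. norm (S (Suc K) s - S K (s + \<beta>)) \<le> 1" for K
      proof
        fix s assume "s \<in> {0..\<alpha>}"
        then show "norm (S (Suc K) s - S K (s + \<beta>)) \<le> 1"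
          using S_bounds[of s "Suc K"] S_bounds[of "s + \<beta>" K] assms(1) by auto
      qed
      show "\<forall>s\<in>{0..\<alpha>}. (\<lambda>K. S (Suc K) s - S K (s + \<beta>)) \<longlonglongrightarrow> R (s + \<beta>) - R s"
      proof
        fix s assume "s \<in> {0..\<alpha>}"
        then have "(\<lambda>K. S (Suc K) s - S K (s + \<beta>)) \<longlonglongrightarrow> (1 - R s) - (1 - R (s + \<beta>))"
          using assms(1) by (intro tendsto_diff lim LIMSEQ_Suc) auto
        then show "(\<lambda>K. S (Suc K) s - S K (s + \<beta>)) \<longlonglongrightarrow> R (s + \<beta>) - R s" by simp
      qed
      show "(\<lambda>K. 1 - S (Suc K) \<alpha>) \<longlonglongrightarrow> R \<alpha>"
        using tendsto_diff[OF tendsto_const[of 1] LIMSEQ_Suc[OF lim[OF that]]] by simp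
    qed auto
    moreover have "((\<lambda>s. R (s + \<beta>)) has_integral integral {\<beta>..\<alpha> + \<beta>} R) {0..\<alpha>}"
      using has_integral_shift_real_ivl[OF integrable_integral[OF R_int[OF assms(1), of "\<alpha> + \<beta>"]], of \<beta>]
      by simp
    ultimately have "R \<alpha> = integral {\<beta>..\<alpha> + \<beta>} R - integral {0..\<alpha>} R"
      using has_integral_diff[OF _ integrable_integral[OF R_int[of 0 \<alpha>]]] has_integral_unique
      by blast
    moreover have "integral {0..\<beta>} R + integral {\<beta>..\<alpha> + \<beta>} R = integral {0..\<alpha> + \<beta>} R"
      using assms(1) that by (intro Henstock_Kurzweil_Integration.integral_combine R_int) auto
    moreover have "integral {0..\<alpha>} R + integral {\<alpha>..\<alpha> + \<beta>} R = integral {0..\<alpha> + \<beta>} R"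
      using assms(1) that by (intro Henstock_Kurzweil_Integration.integral_combine R_int) auto
    ultimately show ?thesis by linarith
  qed
  \<comment> \<open>Iterating \<open>R_eq\<close> takes the place of a supremum argument: the
    subtracted integral is nonnegative, and the other one runs over an interval of length \<beta>,
    so each round gains a factor \<beta>.\<close>
  have "R \<alpha> \<le> \<beta> ^ m" if "0 \<le> \<alpha>" for m \<alpha>
    using that
  proof (induction m arbitrary: \<alpha>)
    case 0
    then show ?case using R_le_1 by simp
  next
    case (Suc m)
    have "0 \<le> integral {0..\<beta>} R"
      using R_nonneg by (intro integral_nonneg R_int) auto
    moreover have "integral {\<alpha>..\<alpha> + \<beta>} R \<le> integral {\<alpha>..\<alpha> + \<beta>} (\<lambda>_. \<beta> ^ m)"
      using Suc by (intro integral_le R_int) auto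
    moreover have "integral {\<alpha>..\<alpha> + \<beta>} (\<lambda>_. \<beta> ^ m) = \<beta> ^ Suc m"
      using assms(1) by simp
    ultimately show ?case using R_eq[OF Suc.prems] by linarith
  qed
  then have "R \<alpha> \<le> 0"
    using LIMSEQ_le_const[OF LIMSEQ_power_zero[of \<beta>], of "R \<alpha>"] assms by simp
  then have "R \<alpha> = 0" using R_nonneg[OF assms(3)] by simp
  then show ?thesis using summable_sums[OF summ[OF assms(3)]] by (simp add: R_def)
qed

section \<open>Integrals of the basis functions\<close>

text \<open>The substitution \<open>u = n * t + k * \<beta>\<close> reduces the integral to Gamma
  integrals. Over the full half-line these give 1 for \<open>k = 0\<close> and
  \<open>1 - \<beta>\<close> for \<open>k > 0\<close>. The resulting lower bound limits the
  normalizing factor of the operator to \<open>n / (1 - \<beta>)\<close>.\<close>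

lemma jain_basis_integral:
  assumes "0 \<le> \<beta>" "\<beta> < 1" "0 < n"
  shows jain_basis_integrable: "set_integrable lborel {0..} (jain_basis \<beta> n k)"
    and jain_basis_integral_ge: "(1 - \<beta>) / real n \<le> (LBINT t:{0..}. jain_basis \<beta> n k t)"
proof -
  \<comment> \<open>This is the basis function in the variable
    \<open>u = n * t + k * \<beta>\<close>; the points \<open>t \<ge> 0\<close> correspond to
    \<open>u \<ge> k * \<beta>\<close>.\<close>
  define h where "h u = (if k = 0 then exp (- u)
      else (u - real k * \<beta>) * u ^ (k - 1) / fact k * exp (- u))" for u :: real
  have "h = (\<lambda>u. (if k = 0 then u ^ 0 * exp (- u)
      else (u ^ k * exp (- u) - real k * \<beta> * (u ^ (k - 1) * exp (- u))) / fact k))"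
    by (auto simp: h_def fun_eq_iff field_simps power_eq_if)
  moreover have "has_bochner_integral lborel
      (\<lambda>u. (if k = 0 then u ^ 0 * exp (- u) * indicator {0..} u
        else (u ^ k * exp (- u) * indicator {0..} u
          - real k * \<beta> * (u ^ (k - 1) * exp (- u) * indicator {0..} u)) / fact k))
      (if k = 0 then fact 0 else (fact k - real k * \<beta> * fact (k - 1)) / fact k)"
    by (cases "k = 0") (auto intro!: has_bochner_integral_I0i_power_exp_m'
      has_bochner_integral_I0i_power_exp_m'[of 0, simplified]
      has_bochner_integral_divide_zero has_bochner_integral_diff has_bochner_integral_mult_right)
  ultimately have h_int: "has_bochner_integral lborel (\<lambda>u. indicator {0..} u * h u)
      (if k = 0 then fact 0 else (fact k - real k * \<beta> * fact (k - 1)) / fact k)"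
    by (elim has_bochner_integral_cong[THEN iffD1, rotated 3]) (auto split: split_indicator)
  moreover have "1 - \<beta> \<le> (if k = 0 then fact 0 else (fact k - real k * \<beta> * fact (k - 1)) / fact k)"
    using assms(1) by (cases k) (simp_all add: diff_divide_distrib)
  ultimately have ge: "1 - \<beta> \<le> (\<integral>u. indicator {0..} u * h u \<partial>lborel)"
    by (simp add: has_bochner_integral_iff)
  define g where "g u = indicator {real k * \<beta>..} u * h u" for u :: real
  have g_int: "integrable lborel g"
  proof (rule Bochner_Integration.integrable_bound)
    show "integrable lborel (\<lambda>u. indicator {0..} u * h u)"
      using h_int by (simp add: has_bochner_integral_iff)
    show "g \<in> borel_measurable lborel"
      unfolding g_def h_def by (cases "k = 0") simp_all
    show "AE u in lborel. norm (g u) \<le> norm (indicator {0..} u * h u)"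
      using order_trans[of 0 "real k * \<beta>"] assms(1)
      by (intro AE_I2) (auto simp: g_def split: split_indicator)
  qed
  \<comment> \<open>On \<open>[0, k\<beta>]\<close> the integrand \<open>h\<close> is nonpositive, so restricting it to \<open>[k\<beta>, \<infinity>)\<close> increases the integral.\<close>
  have "(\<integral>u. indicator {0..} u * h u \<partial>lborel) \<le> (\<integral>u. g u \<partial>lborel)"
  proof (rule integral_mono)
    fix u :: real
    show "indicator {0..} u * h u \<le> g u"
      using order_trans[of 0 "real k * \<beta>" u] assms(1)
      by (auto simp: g_def h_def split: split_indicator intro!: mult_nonpos_nonneg divide_nonpos_pos)
  qed (use h_int g_int in \<open>auto simp: has_bochner_integral_iff\<close>)
  with ge have ge': "1 - \<beta> \<le> (\<integral>u. g u \<partial>lborel)" by linarith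
  have basis: "indicator {0..} t * jain_basis \<beta> n k t = g (real k * \<beta> + real n * t)" for t
    using assms(3) by (auto simp: g_def h_def jain_basis_def zero_le_mult_iff algebra_simps
      split: split_indicator)
  show "set_integrable lborel {0..} (jain_basis \<beta> n k)"
    using lborel_integrable_real_affine[OF g_int, of "real n" "real k * \<beta>"] assms(3)
    by (simp add: set_integrable_def basis)
  have "(\<integral>u. g u \<partial>lborel) = real n * (LBINT t:{0..}. jain_basis \<beta> n k t)"
    using lborel_integral_real_affine[of "real n" g "real k * \<beta>"] assms(3)
    by (simp add: set_lebesgue_integral_def basis)
  then show "(1 - \<beta>) / real n \<le> (LBINT t:{0..}. jain_basis \<beta> n k t)"
    using ge' assms(3) by (simp add: field_simps)
qed

section \<open>Localization of the kernel\<close>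

lemma power_div_fact_le_exp:
  fixes u :: real
  assumes "0 \<le> u"
  shows "u ^ k / fact k \<le> exp u"
proof -
  have "(\<lambda>k. u ^ k / fact k) sums exp u"
    using exp_converges[of u] by (simp add: divide_inverse mult.commute)
  then show ?thesis
    using sum_le_suminf[of "\<lambda>k. u ^ k / fact k" "{k}"] assms
    by (simp add: sums_iff)
qed

definition poisson_weight :: "nat \<Rightarrow> real \<Rightarrow> real" where
  "poisson_weight k u = u ^ k / fact k * exp (- u)"

lemma poisson_weight_nonneg: "0 \<le> u \<Longrightarrow> 0 \<le> poisson_weight k u"
  by (simp add: poisson_weight_def)

lemma poisson_weight_le_1: "0 \<le> u \<Longrightarrow> poisson_weight k u \<le> 1"
  using power_div_fact_le_exp[of u k] by (simp add: poisson_weight_def exp_minus field_simps)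

text \<open>The leading factor \<alpha> is at most \<open>\<alpha> + k * \<beta>\<close>, which
  completes the power to exponent \<open>k\<close>.\<close>

lemma jain_weight_le_poisson_weight:
  assumes "0 \<le> \<beta>" "0 \<le> \<alpha>"
  shows "jain_weight \<beta> k \<alpha> \<le> poisson_weight k (\<alpha> + real k * \<beta>)"
proof (cases k)
  case (Suc j)
  then have "\<alpha> * (\<alpha> + real k * \<beta>) ^ j \<le> (\<alpha> + real k * \<beta>) * (\<alpha> + real k * \<beta>) ^ j"
    using assms by (intro mult_right_mono) auto
  then show ?thesis
    unfolding jain_weight_def poisson_weight_def using Suc
    by (auto intro!: mult_right_mono divide_right_mono)
qed (simp add: jain_weight_def poisson_weight_def)

text \<open>The product of \<open>u ^ k / fact k\<close> and \<open>v ^ k / fact k\<close> is the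
  square of one term of the exponential series at \<open>sqrt (u * v)\<close>. The exponent
  \<open>2 * sqrt (u * v) - u - v\<close> is then a negated square, and the bound is uniform in
  \<open>k\<close>.\<close>

lemma poisson_weight_mult_le:
  assumes "0 \<le> u" "0 \<le> v"
  shows "poisson_weight k u * poisson_weight k v \<le> exp (- (sqrt u - sqrt v)\<^sup>2)"
proof -
  have "(sqrt (u * v)) ^ k / fact k \<le> exp (sqrt (u * v))"
    using assms by (intro power_div_fact_le_exp) simp
  then have "((sqrt (u * v)) ^ k / fact k)\<^sup>2 \<le> (exp (sqrt (u * v)))\<^sup>2"
    using assms by (intro power_mono) auto
  moreover have "((sqrt (u * v)) ^ k / fact k)\<^sup>2 = (u ^ k / fact k) * (v ^ k / fact k)"
  proof -
    have "((sqrt (u * v)) ^ k)\<^sup>2 = ((sqrt (u * v))\<^sup>2) ^ k"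
      by (simp only: power_mult [symmetric] mult.commute)
    then show ?thesis
      using assms by (simp add: power_divide power_mult_distrib) (simp add: power2_eq_square)
  qed
  moreover have "(exp (sqrt (u * v)))\<^sup>2 = exp (2 * (sqrt u * sqrt v))"
    by (simp add: exp_double real_sqrt_mult)
  ultimately have "(u ^ k / fact k) * (v ^ k / fact k) * exp (- (u + v))
      \<le> exp (2 * (sqrt u * sqrt v)) * exp (- (u + v))"
    by (intro mult_right_mono) auto
  also have "\<dots> = exp (- (sqrt u - sqrt v)\<^sup>2)"
    using assms by (simp add: exp_add [symmetric] power2_diff)
  finally show ?thesis
    by (simp add: poisson_weight_def exp_add [symmetric] mult_ac exp_minus exp_diff)
      (simp add: field_simps exp_add)
qed

text \<open>Factor \<open>u - v\<close> as a difference of squares of the roots and use that the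
  squared sum of the roots is at most \<open>2 * (u + v)\<close>.\<close>

lemma square_diff_le_sqrt_diff:
  fixes u v :: real
  assumes "0 \<le> u" "0 \<le> v" "0 < u + v"
  shows "(u - v)\<^sup>2 / (2 * (u + v)) \<le> (sqrt u - sqrt v)\<^sup>2"
proof -
  have "(sqrt u + sqrt v)\<^sup>2 \<le> 2 * (u + v)"
    using sum_squares_bound[of "sqrt u" "sqrt v"] assms by (simp add: power2_sum)
  then have "(sqrt u - sqrt v)\<^sup>2 * (sqrt u + sqrt v)\<^sup>2 \<le> (sqrt u - sqrt v)\<^sup>2 * (2 * (u + v))"
    by (intro mult_left_mono) auto
  moreover have "(sqrt u - sqrt v)\<^sup>2 * (sqrt u + sqrt v)\<^sup>2 = (u - v)\<^sup>2"
    using assms by (simp add: power_mult_distrib [symmetric] algebra_simps)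
  ultimately show ?thesis using assms by (simp add: field_simps)
qed

text \<open>A Chernoff-type bound: estimate \<open>(u / \<gamma>) ^ k / fact k\<close> by
  \<open>exp (u / \<gamma>)\<close>; the remaining exponent
  \<open>(u / \<gamma>) * (1 - \<gamma>)\<close> is at most
  \<open>k * (1 - \<gamma>)\<close>.\<close>

lemma poisson_weight_le_power:
  assumes "0 \<le> u" "0 < \<gamma>" "\<gamma> \<le> 1" "u \<le> \<gamma> * real k"
  shows "poisson_weight k u \<le> (\<gamma> * exp (1 - \<gamma>)) ^ k"
proof -
  have "(u / \<gamma>) ^ k / fact k \<le> exp (u / \<gamma>)"
    using assms by (intro power_div_fact_le_exp) simp
  then have "u ^ k / fact k \<le> \<gamma> ^ k * exp (u / \<gamma>)"
    using assms by (simp add: power_divide field_simps)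
  then have "poisson_weight k u \<le> \<gamma> ^ k * exp (u / \<gamma>) * exp (- u)"
    unfolding poisson_weight_def by (rule mult_right_mono) simp
  also have "\<dots> = \<gamma> ^ k * exp (u / \<gamma> - u)"
    by (simp add: exp_diff exp_minus field_simps)
  also have "u / \<gamma> - u = u / \<gamma> * (1 - \<gamma>)"
    using assms by (simp add: field_simps)
  also have "exp (u / \<gamma> * (1 - \<gamma>)) \<le> exp (real k * (1 - \<gamma>))"
  proof -
    have "u / \<gamma> \<le> real k" using assms by (simp add: field_simps)
    then show ?thesis using assms mult_right_mono[of "u / \<gamma>" "real k" "1 - \<gamma>"] by simp
  qed
  finally show ?thesis
    using assms by (simp add: power_mult_distrib exp_of_nat_mult)
qed

text \<open>This makes the base in \<open>poisson_weight_le_power\<close> smaller than 1, so that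
  the bound there decays geometrically in \<open>k\<close>.\<close>

lemma mult_exp_less_1:
  fixes \<gamma> :: real
  assumes "0 \<le> \<gamma>" "\<gamma> < 1"
  shows "\<gamma> * exp (1 - \<gamma>) < 1"
proof -
  have "1 + (\<gamma> - 1) < exp (\<gamma> - 1)"
    using assms exp_minus_greater[of "1 - \<gamma>"] by simp
  then have "\<gamma> * exp (1 - \<gamma>) < exp (\<gamma> - 1) * exp (1 - \<gamma>)"
    by (intro mult_strict_right_mono) auto
  then show ?thesis by (simp add: exp_add [symmetric])
qed

text \<open>Exponential tilting: the factor \<open>exp (\<theta> * v)\<close> changes the Poisson
  weight at \<open>v\<close> into the one at \<open>(1 - \<theta>) * v\<close>, at the cost of a
  power of \<open>1 / (1 - \<theta>)\<close>.\<close>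

lemma exp_mult_poisson_weight_le:
  assumes "0 \<le> v" "0 \<le> \<theta>" "\<theta> < 1"
  shows "exp (\<theta> * v) * poisson_weight k v \<le> (1 / (1 - \<theta>)) ^ k"
proof -
  have "exp (\<theta> * v) * poisson_weight k v = (1 / (1 - \<theta>)) ^ k * poisson_weight k ((1 - \<theta>) * v)"
  proof -
    have "exp (- ((1 - \<theta>) * v)) = exp (\<theta> * v) * exp (- v)"
      by (simp add: exp_add [symmetric] algebra_simps)
    then show ?thesis
      using assms by (simp add: poisson_weight_def power_mult_distrib power_divide)
  qed
  also have "\<dots> \<le> (1 / (1 - \<theta>)) ^ k * 1"
    using assms by (intro mult_left_mono poisson_weight_le_1) auto
  finally show ?thesis by simp
qed

section \<open>Decay of the kernel away from the diagonal\<close>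

text \<open>For \<open>k \<le> m * n\<close> the sum \<open>u + v\<close> is at most of order
  \<open>n * (1 + t)\<close>, while \<open>u - v\<close> has modulus
  \<open>n * \<bar>t - x\<bar>\<close>, which is of order at least \<open>n * (1 + t)\<close>. The
  growth in \<open>t\<close> of the exponent will later absorb \<open>exp (N * t)\<close>.\<close>

lemma jain_basis_mult_le_near:
  assumes "0 \<le> \<beta>" "\<beta> < 1" "0 \<le> b" "0 < \<delta>"
  obtains c where "0 < c"
    and "\<And>n k x t. \<lbrakk>0 < n; k \<le> m * n; 0 \<le> x; x \<le> b; 0 \<le> t; \<delta> \<le> \<bar>t - x\<bar>\<rbrakk>
      \<Longrightarrow> jain_basis \<beta> n k x * jain_basis \<beta> n k t \<le> exp (- (c * real n * (1 + t)))"
proof -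
  \<comment> \<open>With \<open>d = \<bar>t - x\<bar>\<close>, the constants are chosen so that
    \<open>1 + t \<le> d * p\<close> and \<open>x + t + 2 * m \<le> d * q\<close>; additive
    constants are absorbed through \<open>1 \<le> d / \<delta>\<close>.\<close>
  define p where "p = (1 + b) / \<delta> + 1"
  define q where "q = (2 * b + 2 * real m) / \<delta> + 1"
  have pq: "0 < p" "0 < q" using assms by (auto simp: p_def q_def intro!: add_nonneg_pos)
  show ?thesis
  proof (rule that)
    show "0 < 1 / (2 * p * q)" using pq by simp
    fix n k :: nat and x t :: real
    assume n: "0 < n" and k: "k \<le> m * n" and x: "0 \<le> x" "x \<le> b" and t: "0 \<le> t"
      and d: "\<delta> \<le> \<bar>t - x\<bar>"
    define u v where "u = real n * x + real k * \<beta>" and "v = real n * t + real k * \<beta>"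
    have uv: "0 \<le> u" "0 \<le> v" using assms x t by (auto simp: u_def v_def)
    have "real k * \<beta> \<le> real (m * n) * 1"
      using k assms by (intro mult_mono) (simp_all del: of_nat_mult)
    then have uv_le: "u + v \<le> real n * (x + t + 2 * real m)"
      by (simp add: u_def v_def algebra_simps)
    have uv_diff: "(u - v)\<^sup>2 = real n * real n * \<bar>t - x\<bar>\<^sup>2"
      by (simp add: u_def v_def power2_eq_square algebra_simps)
    have "0 < \<bar>u - v\<bar>"
      using n d assms(4) by (simp add: u_def v_def flip: right_diff_distrib)
    then have uv_pos: "0 < u + v" using uv by linarith
    define d where "d = \<bar>t - x\<bar>"
    have d_ge: "1 \<le> d / \<delta>" using d assms(4) by (simp add: d_def)
    have "1 + t \<le> (1 + b) * 1 + d" using x by (simp add: d_def)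
    also have "\<dots> \<le> (1 + b) * (d / \<delta>) + d"
      using d_ge assms(3) by (intro add_mono mult_left_mono) auto
    finally have 1: "1 + t \<le> d * p" by (simp add: p_def algebra_simps add_divide_distrib)
    have "x + t + 2 * real m \<le> (2 * b + 2 * real m) * 1 + d" using x by (simp add: d_def)
    also have "\<dots> \<le> (2 * b + 2 * real m) * (d / \<delta>) + d"
      using d_ge assms(3) by (intro add_mono mult_left_mono) auto
    finally have 2: "x + t + 2 * real m \<le> d * q" by (simp add: q_def algebra_simps add_divide_distrib)
    have "(1 + t) * (x + t + 2 * real m) \<le> (d * p) * (d * q)"
      using 1 2 x t pq by (intro mult_mono) (auto simp: d_def)
    then have 3: "1 / (2 * p * q) * (1 + t) * (2 * (x + t + 2 * real m)) \<le> d\<^sup>2"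
      using pq by (simp add: field_simps power2_eq_square)
    have "1 / (2 * p * q) * real n * (1 + t) * (2 * (u + v))
        \<le> 1 / (2 * p * q) * real n * (1 + t) * (2 * (real n * (x + t + 2 * real m)))"
      using uv_le pq t by (intro mult_left_mono) auto
    also have "\<dots> = real n * real n * (1 / (2 * p * q) * (1 + t) * (2 * (x + t + 2 * real m)))"
      by (simp add: mult_ac)
    also have "\<dots> \<le> real n * real n * d\<^sup>2"
      using 3 by (intro mult_left_mono) auto
    finally have "1 / (2 * p * q) * real n * (1 + t) * (2 * (u + v)) \<le> (u - v)\<^sup>2"
      by (simp add: uv_diff d_def)
    then have "1 / (2 * p * q) * real n * (1 + t) \<le> (u - v)\<^sup>2 / (2 * (u + v))"
      using uv_pos by (subst pos_le_divide_eq) auto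
    also have "\<dots> \<le> (sqrt u - sqrt v)\<^sup>2"
      by (rule square_diff_le_sqrt_diff[OF uv uv_pos])
    finally have 4: "1 / (2 * p * q) * real n * (1 + t) \<le> (sqrt u - sqrt v)\<^sup>2" .
    have "jain_basis \<beta> n k x * jain_basis \<beta> n k t \<le> poisson_weight k u * poisson_weight k v"
      unfolding jain_basis_scale u_def v_def using assms x t
      by (intro mult_mono jain_weight_le_poisson_weight jain_weight_nonneg poisson_weight_nonneg) auto
    also have "\<dots> \<le> exp (- (sqrt u - sqrt v)\<^sup>2)"
      by (rule poisson_weight_mult_le[OF uv])
    also have "\<dots> \<le> exp (- (1 / (2 * p * q) * real n * (1 + t)))"
      using 4 by simp
    finally show "jain_basis \<beta> n k x * jain_basis \<beta> n k t
        \<le> exp (- (1 / (2 * p * q) * real n * (1 + t)))" .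
  qed
qed

text \<open>For \<open>k \<ge> m * n\<close> the argument \<open>u = n * x + k * \<beta>\<close>
  stays below \<open>\<gamma> * k\<close> with \<open>\<gamma> < 1\<close>, so the weight at
  \<open>x\<close> is at most \<open>q ^ k\<close>. Tilting by \<open>\<theta> = N / n\<close>
  absorbs \<open>exp (N * t)\<close> and raises the base only to \<open>q / (1 - \<theta>)\<close>,
  which is below \<open>r\<close> for large \<open>n\<close>; \<open>m\<close> and \<open>r\<close>
  do not depend on \<open>N\<close>.\<close>

lemma jain_basis_mult_le_far:
  assumes "0 \<le> \<beta>" "\<beta> < 1" "0 \<le> b"
  obtains m :: nat and r where "1 \<le> m" "0 < r" "r < 1"
    and "\<And>N. \<forall>\<^sub>F n in sequentially. \<forall>k x t. m * n \<le> k \<longrightarrow> 0 \<le> x \<longrightarrow> x \<le> b \<longrightarrow> 0 \<le> t \<longrightarrow>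
      exp (real N * t) * (jain_basis \<beta> n k x * jain_basis \<beta> n k t) \<le> r ^ k"
proof -
  define \<gamma> where "\<gamma> = (1 + \<beta>) / 2"
  define q where "q = \<gamma> * exp (1 - \<gamma>)"
  define r where "r = (1 + q) / 2"
  have \<gamma>: "0 < \<gamma>" "\<gamma> < 1" "\<beta> < \<gamma>" using assms by (auto simp: \<gamma>_def)
  have q: "0 < q" "q < 1" using mult_exp_less_1[of \<gamma>] \<gamma> by (auto simp: q_def)
  have r: "0 < r" "r < 1" "q < r" using q by (auto simp: r_def)
  \<comment> \<open>The choice of \<open>m0\<close> gives
    \<open>n * x \<le> k * (\<gamma> - \<beta>)\<close> whenever
    \<open>k \<ge> Suc m0 * n\<close>.\<close>
  obtain m0 :: nat where "b / (\<gamma> - \<beta>) \<le> real m0" using real_arch_simple by blast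
  then have m: "b \<le> real (Suc m0) * (\<gamma> - \<beta>)" using \<gamma> by (simp add: field_simps)
  show ?thesis
  proof (rule that[of "Suc m0" r])
    fix N :: nat
    have "(\<lambda>n. q / (1 - real N / real n)) \<longlonglongrightarrow> q"
      by real_asymp
    then have "\<forall>\<^sub>F n in sequentially. q / (1 - real N / real n) < r"
      using r(3) by (rule order_tendstoD)
    then show "\<forall>\<^sub>F n in sequentially. \<forall>k x t. Suc m0 * n \<le> k \<longrightarrow> 0 \<le> x \<longrightarrow> x \<le> b \<longrightarrow> 0 \<le> t \<longrightarrow>
      exp (real N * t) * (jain_basis \<beta> n k x * jain_basis \<beta> n k t) \<le> r ^ k"
      using eventually_gt_at_top[of N]
    proof eventually_elim
      fix n assume qr: "q / (1 - real N / real n) < r" and n: "N < n"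
      define \<theta> where "\<theta> = real N / real n"
      have \<theta>: "0 \<le> \<theta>" "\<theta> < 1" using n by (auto simp: \<theta>_def)
      show "\<forall>k x t. Suc m0 * n \<le> k \<longrightarrow> 0 \<le> x \<longrightarrow> x \<le> b \<longrightarrow> 0 \<le> t \<longrightarrow>
        exp (real N * t) * (jain_basis \<beta> n k x * jain_basis \<beta> n k t) \<le> r ^ k"
      proof (intro allI impI)
        fix k x t assume k: "Suc m0 * n \<le> k" and x: "0 \<le> x" "x \<le> b" and t: "0 \<le> (t::real)"
        define u v where "u = real n * x + real k * \<beta>" and "v = real n * t + real k * \<beta>"
        have uv: "0 \<le> u" "0 \<le> v" using assms x t by (auto simp: u_def v_def)
        have "real n * x \<le> real n * (real (Suc m0) * (\<gamma> - \<beta>))"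
          using x m by (intro mult_left_mono) auto
        also have "\<dots> = real (Suc m0 * n) * (\<gamma> - \<beta>)" by (simp add: algebra_simps)
        also have "\<dots> \<le> real k * (\<gamma> - \<beta>)"
          using k \<gamma> by (intro mult_right_mono) (simp_all del: of_nat_mult mult_Suc)
        finally have "u \<le> \<gamma> * real k" by (simp add: u_def algebra_simps)
        then have Pu: "poisson_weight k u \<le> q ^ k"
          unfolding q_def using uv \<gamma> by (intro poisson_weight_le_power) auto
        have "\<theta> * v = real N * t + \<theta> * (real k * \<beta>)"
          using n by (simp add: \<theta>_def v_def field_simps)
        then have "real N * t \<le> \<theta> * v"
          using \<theta> assms by simp
        then have "exp (real N * t) * poisson_weight k v \<le> exp (\<theta> * v) * poisson_weight k v"
          using uv by (intro mult_right_mono poisson_weight_nonneg) auto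
        also have "\<dots> \<le> (1 / (1 - \<theta>)) ^ k"
          by (rule exp_mult_poisson_weight_le[OF uv(2) \<theta>])
        finally have Pv: "exp (real N * t) * poisson_weight k v \<le> (1 / (1 - \<theta>)) ^ k" .
        have "jain_basis \<beta> n k x * jain_basis \<beta> n k t \<le> poisson_weight k u * poisson_weight k v"
          unfolding jain_basis_scale u_def v_def using assms x t
          by (intro mult_mono jain_weight_le_poisson_weight jain_weight_nonneg poisson_weight_nonneg) auto
        then have "exp (real N * t) * (jain_basis \<beta> n k x * jain_basis \<beta> n k t)
            \<le> exp (real N * t) * (poisson_weight k u * poisson_weight k v)"
          by (rule mult_left_mono) simp
        also have "\<dots> = poisson_weight k u * (exp (real N * t) * poisson_weight k v)"
          by simp
        also have "\<dots> \<le> q ^ k * (1 / (1 - \<theta>)) ^ k"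
          using q uv by (intro mult_mono Pu Pv) (auto intro!: mult_nonneg_nonneg poisson_weight_nonneg)
        also have "\<dots> = (q / (1 - \<theta>)) ^ k" by (simp add: power_divide)
        also have "\<dots> \<le> r ^ k"
          using qr q \<theta> by (intro power_mono) (auto simp: \<theta>_def)
        finally show "exp (real N * t) * (jain_basis \<beta> n k x * jain_basis \<beta> n k t) \<le> r ^ k" .
      qed
    qed
  qed (use r in auto)
qed

text \<open>The two regimes of \<open>k\<close> are joined into one majorant free of
  \<open>x\<close> and \<open>t\<close>. Its sum is of order
  \<open>n * exp (- (c * n)) + s ^ n\<close>, which beats the factor \<open>n\<close> from the
  normalizing integrals.\<close>

lemma jain_kernel_tail_majorant:
  assumes "0 \<le> \<beta>" "\<beta> < 1" "0 \<le> b" "0 < \<delta>"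
  obtains B :: "nat \<Rightarrow> nat \<Rightarrow> real" where "\<And>n k. 0 \<le> B n k" "\<And>n. summable (B n)"
    and "(\<lambda>n. real n * suminf (B n)) \<longlonglongrightarrow> 0"
    and "\<forall>\<^sub>F n in sequentially. \<forall>k x t. 0 \<le> x \<longrightarrow> x \<le> b \<longrightarrow> 0 \<le> t \<longrightarrow> \<delta> \<le> \<bar>t - x\<bar> \<longrightarrow>
      exp (real N * t) * (jain_basis \<beta> n k x * jain_basis \<beta> n k t) \<le> B n k"
proof -
  obtain m :: nat and r where m: "1 \<le> m" and r: "0 < r" "r < 1"
    and far: "\<And>N. \<forall>\<^sub>F n in sequentially. \<forall>k x t. m * n \<le> k \<longrightarrow> 0 \<le> x \<longrightarrow> x \<le> b \<longrightarrow> 0 \<le> t \<longrightarrow>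
      exp (real N * t) * (jain_basis \<beta> n k x * jain_basis \<beta> n k t) \<le> r ^ k"
    by (rule jain_basis_mult_le_far[OF assms(1-3)]) (rule that)
  obtain c where c: "0 < c"
    and near: "\<And>n k x t. \<lbrakk>0 < n; k \<le> m * n; 0 \<le> x; x \<le> b; 0 \<le> t; \<delta> \<le> \<bar>t - x\<bar>\<rbrakk>
      \<Longrightarrow> jain_basis \<beta> n k x * jain_basis \<beta> n k t \<le> exp (- (c * real n * (1 + t)))"
    by (rule jain_basis_mult_le_near[OF assms]) (rule that)
  \<comment> \<open>Splitting \<open>r ^ k\<close> as \<open>s ^ k * s ^ k\<close> lets one factor
    sum over \<open>k\<close> while the other, as \<open>k \<ge> n\<close> in the far regime, yields
    the decay \<open>s ^ n\<close>.\<close>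
  define s where "s = sqrt r"
  have s: "0 < s" "s < 1" "s * s = r" using r by (auto simp: s_def)
  define B where "B n k = (if k \<in> {..m * n} then exp (- (c * real n)) else 0) + s ^ n * s ^ k"
    for n k
  have "(\<lambda>k. if k \<in> {..m * n} then exp (- (c * real n)) else 0) sums (\<Sum>k\<le>m * n. exp (- (c * real n)))"
    for n by (rule sums_If_finite_set) simp
  moreover have "(\<lambda>k. s ^ n * s ^ k) sums (s ^ n * (1 / (1 - s)))" for n
    using s by (intro sums_mult geometric_sums) auto
  ultimately have B_sums: "B n sums ((\<Sum>k\<le>m * n. exp (- (c * real n))) + s ^ n * (1 / (1 - s)))" for n
    unfolding B_def by (rule sums_add)
  show ?thesis
  proof (rule that)
    show "0 \<le> B n k" for n k using s by (auto simp: B_def)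
    show "summable (B n)" for n using B_sums by (rule sums_summable)
    have "(\<lambda>n. real n * exp (- (c * real n))) \<longlonglongrightarrow> 0"
      "(\<lambda>n. real n * real n * exp (- (c * real n))) \<longlonglongrightarrow> 0"
      using c by real_asymp+
    moreover have "(\<lambda>n. real n * s ^ n) \<longlonglongrightarrow> 0"
      using s by (intro powser_times_n_limit_0) auto
    ultimately have "(\<lambda>n. real n * exp (- (c * real n))
        + real m * (real n * real n * exp (- (c * real n)))
        + real n * s ^ n * (1 / (1 - s))) \<longlonglongrightarrow> 0 + real m * 0 + 0 * (1 / (1 - s))"
      by (intro tendsto_intros)
    moreover have "real n * suminf (B n) = real n * exp (- (c * real n))
        + real m * (real n * real n * exp (- (c * real n)))
        + real n * s ^ n * (1 / (1 - s))" for n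
      by (simp add: sums_unique[OF B_sums, symmetric] distrib_left distrib_right mult_ac)
    ultimately show "(\<lambda>n. real n * suminf (B n)) \<longlonglongrightarrow> 0"
      by simp
    \<comment> \<open>From \<open>n0\<close> on, \<open>N \<le> c * n\<close>, so the near bound
      absorbs \<open>exp (N * t)\<close> and still leaves \<open>exp (- (c * n))\<close>.\<close>
    obtain n0 :: nat where n0: "real N / c \<le> real n0" using real_arch_simple by blast
    show "\<forall>\<^sub>F n in sequentially. \<forall>k x t. 0 \<le> x \<longrightarrow> x \<le> b \<longrightarrow> 0 \<le> t \<longrightarrow> \<delta> \<le> \<bar>t - x\<bar> \<longrightarrow>
      exp (real N * t) * (jain_basis \<beta> n k x * jain_basis \<beta> n k t) \<le> B n k"
      using far[of N] eventually_ge_at_top[of "Suc n0"]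
    proof eventually_elim
      fix n
      assume far: "\<forall>k x t. m * n \<le> k \<longrightarrow> 0 \<le> x \<longrightarrow> x \<le> b \<longrightarrow> 0 \<le> t \<longrightarrow>
          exp (real N * t) * (jain_basis \<beta> n k x * jain_basis \<beta> n k t) \<le> r ^ k"
        and n: "Suc n0 \<le> n"
      have "real N \<le> c * real n0" using n0 c by (simp add: field_simps)
      also have "\<dots> \<le> c * real n" using n c by simp
      finally have Nc: "real N \<le> c * real n" .
      show "\<forall>k x t. 0 \<le> x \<longrightarrow> x \<le> b \<longrightarrow> 0 \<le> t \<longrightarrow> \<delta> \<le> \<bar>t - x\<bar> \<longrightarrow>
        exp (real N * t) * (jain_basis \<beta> n k x * jain_basis \<beta> n k t) \<le> B n k"
      proof (intro allI impI)
        fix k x t assume x: "0 \<le> x" "x \<le> b" and t: "0 \<le> (t::real)" and d: "\<delta> \<le> \<bar>t - x\<bar>"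
        show "exp (real N * t) * (jain_basis \<beta> n k x * jain_basis \<beta> n k t) \<le> B n k"
        proof (cases "k \<le> m * n")
          case True
          have "exp (real N * t) * (jain_basis \<beta> n k x * jain_basis \<beta> n k t)
              \<le> exp (real N * t) * exp (- (c * real n * (1 + t)))"
            using near[of n k x t] True n x t d by (intro mult_left_mono) auto
          also have "\<dots> = exp (real N * t - c * real n * (1 + t))"
            by (simp add: exp_add [symmetric])
          also have "\<dots> \<le> exp (- (c * real n))"
            using mult_right_mono[OF Nc t] by (simp add: algebra_simps)
          also have "\<dots> \<le> B n k" using True s by (simp add: B_def)
          finally show ?thesis .
        next
          case False
          have "n \<le> m * n" using m by simp
          then have "n \<le> k" using False by linarith
          have "exp (real N * t) * (jain_basis \<beta> n k x * jain_basis \<beta> n k t) \<le> r ^ k"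
            using far False x t by simp
          also have "r ^ k = s ^ k * s ^ k" by (simp add: s(3) [symmetric] power_mult_distrib)
          also have "\<dots> \<le> s ^ n * s ^ k"
            using s \<open>n \<le> k\<close> by (intro mult_right_mono power_decreasing) auto
          also have "\<dots> \<le> B n k" by (simp add: B_def)
          finally show ?thesis .
        qed
      qed
    qed
  qed
qed

section \<open>Convergence\<close>

text \<open>Writing \<open>f x\<close> as the normalized integral of the constant \<open>f x\<close>
  against the basis function puts \<open>f t - f x\<close> under the integral. The normalizing
  integral cancels in the \<epsilon> part; in the other part its inverse is at most
  \<open>n / (1 - \<beta>)\<close>.\<close>

lemma jain_durrmeyer_term_diff_le:
  assumes "0 \<le> \<beta>" "\<beta> < 1" "0 < n" "0 \<le> x" "0 \<le> B"
    and f: "set_integrable lborel {0..} (\<lambda>t. jain_basis \<beta> n k t * f t)"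
    and W: "set_integrable lborel {0..} W" "\<And>t. 0 \<le> t \<Longrightarrow> 0 \<le> W t"
    and bound: "\<And>t. 0 \<le> t \<Longrightarrow> jain_basis \<beta> n k x * (jain_basis \<beta> n k t * \<bar>f t - f x\<bar>)
      \<le> \<epsilon> * jain_basis \<beta> n k x * jain_basis \<beta> n k t + B * W t"
  shows "\<bar>jain_durrmeyer_term \<beta> n f x k - jain_basis \<beta> n k x * f x\<bar>
    \<le> \<epsilon> * jain_basis \<beta> n k x + real n / (1 - \<beta>) * B * (LBINT t:{0..}. W t)"
proof -
  define L where "L = jain_basis \<beta> n k"
  define c where "c = (LBINT t:{0..}. L t)"
  have L_int: "set_integrable lborel {0..} L"
    unfolding L_def by (rule jain_basis_integrable[OF assms(1-3)])
  have L_nonneg: "0 \<le> L t" if "0 \<le> t" for t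
    using jain_weight_nonneg assms(1) that by (simp add: L_def jain_basis_scale)
  have c_ge: "(1 - \<beta>) / real n \<le> c"
    unfolding c_def L_def by (rule jain_basis_integral_ge[OF assms(1-3)])
  then have c_pos: "0 < c"
    using assms(2,3) by (smt (verit) divide_pos_pos of_nat_0_less_iff)
  have W_nonneg: "0 \<le> (LBINT t:{0..}. W t)"
    unfolding set_lebesgue_integral_def using W(2)
    by (intro integral_nonneg_AE AE_I2) (auto split: split_indicator)
  have f: "set_integrable lborel {0..} (\<lambda>t. L t * f t)"
    using f by (simp add: L_def)
  have diff_int: "set_integrable lborel {0..} (\<lambda>t. L t * f t - f x * L t)"
    by (intro set_integral_diff f set_integrable_mult_right L_int)
  have "L x * \<bar>(LBINT t:{0..}. L t * f t) - f x * c\<bar> = L x * \<bar>LBINT t:{0..}. L t * f t - f x * L t\<bar>"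
    using f L_int by (simp add: c_def set_integral_diff)
  also have "\<dots> \<le> L x * (LBINT t:{0..}. \<bar>L t * f t - f x * L t\<bar>)"
    using L_nonneg[OF assms(4)] set_integral_norm_bound[OF diff_int]
    by (intro mult_left_mono) auto
  also have "\<dots> = (LBINT t:{0..}. L x * \<bar>L t * f t - f x * L t\<bar>)" by simp
  also have "\<dots> \<le> (LBINT t:{0..}. (\<epsilon> * L x) * L t + B * W t)"
  proof (rule set_integral_mono)
    show "set_integrable lborel {0..} (\<lambda>t. L x * \<bar>L t * f t - f x * L t\<bar>)"
      by (intro set_integrable_mult_right set_integrable_abs diff_int)
    show "set_integrable lborel {0..} (\<lambda>t. (\<epsilon> * L x) * L t + B * W t)"
      by (intro set_integral_add set_integrable_mult_right L_int W)
    fix t :: real assume "t \<in> {0..}"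
    then have t: "0 \<le> t" by simp
    have "L t * f t - f x * L t = L t * (f t - f x)"
      by (simp add: algebra_simps)
    then have "\<bar>L t * f t - f x * L t\<bar> = L t * \<bar>f t - f x\<bar>"
      using L_nonneg[OF t] by (simp add: abs_mult)
    then show "L x * \<bar>L t * f t - f x * L t\<bar> \<le> (\<epsilon> * L x) * L t + B * W t"
      using bound[OF t] by (simp add: L_def)
  qed
  also have "\<dots> = \<epsilon> * L x * c + B * (LBINT t:{0..}. W t)"
    using L_int W(1) by (simp add: c_def set_integral_add)
  finally have main: "L x * \<bar>(LBINT t:{0..}. L t * f t) - f x * c\<bar>
      \<le> \<epsilon> * L x * c + B * (LBINT t:{0..}. W t)" .
  have "jain_durrmeyer_term \<beta> n f x k - L x * f x = L x * ((LBINT t:{0..}. L t * f t) - f x * c) / c"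
    using c_pos by (simp add: jain_durrmeyer_term_def L_def [symmetric] c_def [symmetric] field_simps)
  then have "\<bar>jain_durrmeyer_term \<beta> n f x k - L x * f x\<bar>
      = L x * \<bar>(LBINT t:{0..}. L t * f t) - f x * c\<bar> / c"
    using c_pos L_nonneg[OF assms(4)] by (simp add: abs_mult)
  also have "\<dots> \<le> (\<epsilon> * L x * c + B * (LBINT t:{0..}. W t)) / c"
    using main c_pos by (intro divide_right_mono) auto
  also have "\<dots> = \<epsilon> * L x + 1 / c * (B * (LBINT t:{0..}. W t))"
    using c_pos by (simp add: field_simps)
  also have "\<dots> \<le> \<epsilon> * L x + real n / (1 - \<beta>) * (B * (LBINT t:{0..}. W t))"
  proof -
    have "1 / c \<le> real n / (1 - \<beta>)"
      using c_ge c_pos assms(2,3) by (simp add: field_simps)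
    then show ?thesis
      using assms(5) W_nonneg by (intro add_left_mono mult_right_mono) auto
  qed
  finally show ?thesis by (simp add: L_def mult.assoc)
qed

text \<open>Eventual definedness enters twice: at one fixed index \<open>N\<close> it controls the
  growth of \<open>f\<close>, and at each large \<open>n\<close> it makes the integrals and the
  series of the operator converge.\<close>

theorem proposition1:
  fixes \<beta> a b :: real and f :: "real \<Rightarrow> real"
  assumes "0 \<le> \<beta>" and "\<beta> < 1"
    and "continuous_on {0..} f"
    and "eventually (\<lambda>n. jain_durrmeyer_defined \<beta> n f) sequentially"
    and "0 \<le> a" and "a \<le> b"
  shows "uniform_limit {a..b} (\<lambda>n x. jain_durrmeyer \<beta> n f x) f sequentially"
proof (rule uniform_limitI)
  fix \<epsilon> :: real assume \<epsilon>: "0 < \<epsilon>"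
  obtain N0 where N0: "\<And>n. N0 \<le> n \<Longrightarrow> jain_durrmeyer_defined \<beta> n f"
    using assms(4) by (auto simp: eventually_sequentially)
  \<comment> \<open>The successor ensures that \<open>N\<close> is positive, so that
    \<open>exp (- (N * t))\<close> is integrable on the half-line.\<close>
  define N where "N = Suc N0"
  \<comment> \<open>The margin of 1 beyond \<open>b\<close> keeps every \<open>t \<ge> 0\<close>
    within \<delta> of \<open>x\<close> inside the compact interval, as \<delta> will be at most
    1.\<close>
  have cont: "continuous_on {0..b + 1} f"
    using assms(3) by (rule continuous_on_subset) auto
  then have "bounded (f ` {0..b + 1})"
    by (intro compact_imp_bounded compact_continuous_image compact_Icc)
  then obtain F where F: "\<And>x. x \<in> {0..b + 1} \<Longrightarrow> \<bar>f x\<bar> \<le> F"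
    unfolding bounded_iff by (metis imageI real_norm_def)
  have "0 \<le> F" using F[of 0] assms(5,6) by fastforce
  have "uniformly_continuous_on {0..b + 1} f"
    using cont by (rule compact_uniformly_continuous) auto
  then obtain \<delta>0 where \<delta>0: "0 < \<delta>0"
    and uc: "\<And>x t. \<lbrakk>x \<in> {0..b + 1}; t \<in> {0..b + 1}; \<bar>t - x\<bar> < \<delta>0\<rbrakk> \<Longrightarrow> \<bar>f t - f x\<bar> < \<epsilon> / 2"
    using \<epsilon> unfolding uniformly_continuous_on_def dist_real_def by (metis half_gt_zero)
  define \<delta> where "\<delta> = min \<delta>0 1"
  have \<delta>: "0 < \<delta>" "\<delta> \<le> \<delta>0" "\<delta> \<le> 1" using \<delta>0 by (auto simp: \<delta>_def)
  \<comment> \<open>The factor \<open>exp (- (N * t))\<close> is the basis function with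
    \<open>k = 0\<close> and \<open>n = N\<close>, hence \<open>W\<close> is integrable; it
    dominates \<open>exp (- (N * t)) * \<bar>f t - f x\<bar>\<close> for all \<open>x\<close> in
    question.\<close>
  define W where "W t = exp (- (real N * t)) * (\<bar>f t\<bar> + F)" for t
  have W_nonneg: "0 \<le> W t" for t using \<open>0 \<le> F\<close> by (simp add: W_def)
  have W_int: "set_integrable lborel {0..} W"
  proof -
    have "set_integrable lborel {0..} (\<lambda>t. \<bar>jain_basis \<beta> N 0 t * f t\<bar> + F * jain_basis \<beta> N 0 t)"
      using N0[of N] assms(1,2)
      by (intro set_integral_add set_integrable_abs set_integrable_mult_right jain_basis_integrable)
        (auto simp: N_def jain_durrmeyer_defined_def)
    also have "(\<lambda>t. \<bar>jain_basis \<beta> N 0 t * f t\<bar> + F * jain_basis \<beta> N 0 t) = W"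
      by (simp add: fun_eq_iff W_def jain_basis_def abs_mult algebra_simps)
    finally show ?thesis .
  qed
  define M where "M = (LBINT t:{0..}. W t)"
  obtain B :: "nat \<Rightarrow> nat \<Rightarrow> real" where B_nonneg: "\<And>n k. 0 \<le> B n k"
    and B_summable: "\<And>n. summable (B n)"
    and B_lim: "(\<lambda>n. real n * suminf (B n)) \<longlonglongrightarrow> 0"
    and B: "\<forall>\<^sub>F n in sequentially. \<forall>k x t. 0 \<le> x \<longrightarrow> x \<le> b \<longrightarrow> 0 \<le> t \<longrightarrow> \<delta> \<le> \<bar>t - x\<bar> \<longrightarrow>
      exp (real N * t) * (jain_basis \<beta> n k x * jain_basis \<beta> n k t) \<le> B n k"
    by (rule jain_kernel_tail_majorant[OF assms(1,2) order_trans[OF assms(5,6)] \<delta>(1)]) (rule that)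
  have "(\<lambda>n. real n * suminf (B n) * (M / (1 - \<beta>))) \<longlonglongrightarrow> 0"
    using B_lim by (rule tendsto_mult_left_zero)
  then have "\<forall>\<^sub>F n in sequentially. real n * suminf (B n) * (M / (1 - \<beta>)) < \<epsilon> / 2"
    using \<epsilon> by (intro order_tendstoD(2)) auto
  with B eventually_gt_at_top[of N0]
  show "\<forall>\<^sub>F n in sequentially. \<forall>x\<in>{a..b}. dist (jain_durrmeyer \<beta> n f x) (f x) < \<epsilon>"
  proof eventually_elim
    fix n
    assume B: "\<forall>k x t. 0 \<le> x \<longrightarrow> x \<le> b \<longrightarrow> 0 \<le> t \<longrightarrow> \<delta> \<le> \<bar>t - x\<bar> \<longrightarrow>
        exp (real N * t) * (jain_basis \<beta> n k x * jain_basis \<beta> n k t) \<le> B n k"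
      and n: "N0 < n"
      and small: "real n * suminf (B n) * (M / (1 - \<beta>)) < \<epsilon> / 2"
    have defd: "jain_durrmeyer_defined \<beta> n f" using N0 n by simp
    show "\<forall>x\<in>{a..b}. dist (jain_durrmeyer \<beta> n f x) (f x) < \<epsilon>"
    proof
      fix x assume "x \<in> {a..b}"
      then have x: "0 \<le> x" "x \<le> b" using assms(5) by auto
      define L where "L k = jain_basis \<beta> n k" for k
      have L_nonneg: "0 \<le> L k t" if "0 \<le> t" for k t
        using jain_weight_nonneg assms(1) that by (simp add: L_def jain_basis_scale)
      have L_sums: "(\<lambda>k. L k x) sums 1"
        unfolding L_def jain_basis_scale using assms(1,2) x by (intro jain_weight_sums_1) auto
      \<comment> \<open>Close to \<open>x\<close> uniform continuity gives the \<epsilon> term; at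
        distance at least \<delta> the majorant, multiplied by \<open>exp (- (N * t))\<close>, gives
        the \<open>W\<close> term.\<close>
      have kernel: "L k x * (L k t * \<bar>f t - f x\<bar>) \<le> \<epsilon> / 2 * L k x * L k t + B n k * W t"
        if t: "0 \<le> t" for k t
      proof (cases "\<bar>t - x\<bar> < \<delta>")
        case True
        then have "\<bar>f t - f x\<bar> \<le> \<epsilon> / 2"
          using uc[of x t] x t \<delta> by fastforce
        then have "(L k x * L k t) * \<bar>f t - f x\<bar> \<le> (L k x * L k t) * (\<epsilon> / 2)"
          using L_nonneg x t by (intro mult_left_mono) auto
        moreover have "0 \<le> B n k * W t" using B_nonneg W_nonneg by simp
        ultimately show ?thesis by (simp add: mult_ac)
      next
        case False
        have "L k x * L k t = exp (real N * t) * (L k x * L k t) * exp (- (real N * t))"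
          by (simp add: exp_minus)
        also have "\<dots> \<le> B n k * exp (- (real N * t))"
          using B False x t by (intro mult_right_mono) (auto simp: L_def)
        finally have "L k x * L k t \<le> B n k * exp (- (real N * t))" .
        moreover have "\<bar>f t - f x\<bar> \<le> \<bar>f t\<bar> + F"
          using F[of x] x by simp
        moreover have "0 \<le> B n k * exp (- (real N * t))"
          using B_nonneg by simp
        ultimately have "(L k x * L k t) * \<bar>f t - f x\<bar>
            \<le> (B n k * exp (- (real N * t))) * (\<bar>f t\<bar> + F)"
          by (rule mult_mono) simp
        moreover have "0 \<le> \<epsilon> / 2 * L k x * L k t"
          using \<epsilon> L_nonneg x t by simp
        ultimately show ?thesis by (simp add: W_def mult_ac)
      qed
      have term_le: "\<bar>jain_durrmeyer_term \<beta> n f x k - L k x * f x\<bar>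
          \<le> \<epsilon> / 2 * L k x + real n / (1 - \<beta>) * B n k * M" for k
        unfolding L_def M_def
        using assms(1,2) n x B_nonneg defd W_int W_nonneg kernel[unfolded L_def]
        by (intro jain_durrmeyer_term_diff_le) (auto simp: jain_durrmeyer_defined_def)
      have "(\<lambda>k. jain_durrmeyer_term \<beta> n f x k) sums jain_durrmeyer \<beta> n f x"
        unfolding jain_durrmeyer_def using defd x
        by (intro summable_sums) (auto simp: jain_durrmeyer_defined_def)
      \<comment> \<open>Since the weights at \<open>x\<close> have total mass 1, subtracting
        \<open>L k x * f x\<close> from each term subtracts exactly \<open>f x\<close> from the
        sum.\<close>
      then have diff_sums: "(\<lambda>k. jain_durrmeyer_term \<beta> n f x k - L k x * f x)
          sums (jain_durrmeyer \<beta> n f x - 1 * f x)"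
        by (intro sums_diff sums_mult2 L_sums)
      have bound_sums: "(\<lambda>k. \<epsilon> / 2 * L k x + real n / (1 - \<beta>) * B n k * M)
          sums (\<epsilon> / 2 * 1 + real n / (1 - \<beta>) * suminf (B n) * M)"
        by (intro sums_add sums_mult sums_mult2 L_sums summable_sums B_summable)
      have "\<bar>jain_durrmeyer \<beta> n f x - f x\<bar>
          \<le> \<epsilon> / 2 * 1 + real n / (1 - \<beta>) * suminf (B n) * M"
        using norm_suminf_le[of "\<lambda>k. jain_durrmeyer_term \<beta> n f x k - L k x * f x", OF _
            sums_summable[OF bound_sums]] term_le
          sums_unique[OF diff_sums] sums_unique[OF bound_sums] by simp
      also have "\<dots> = \<epsilon> / 2 + real n * suminf (B n) * (M / (1 - \<beta>))"
        by (simp add: mult_ac)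
      also have "\<dots> < \<epsilon>" using small by linarith
      finally show "dist (jain_durrmeyer \<beta> n f x) (f x) < \<epsilon>" by (simp add: dist_real_def)
    qed
  qed
qed

end
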